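(* Let $(S_O,P_O)$ be a deductive source with reconstruction alphabet $\hat S_O$, and fix an integer $\delta\ge 0$. Assume $A_\delta\subseteq\hat S_O$ and that $R_\delta(a_1)\cap R_\delta(a_2)=\varnothing$ for all distinct $a_1,a_2\in A_\delta$. Then $$R_{\mathrm{sem}}(0,\delta;d_{\mathrm{Cn}}^{\delta},P_O)=P_\delta\,H(\pi_\delta),$$ with the convention that the right-hand side is $0$ when $P_\delta=0$.
   Context: Setting. $\mathbb{S}_O$ is a finite set of statements with a fixed proof system with decidable derivability; $\mathrm{Cn}(\Gamma)\subseteq\mathbb{S}_O$ is the set of statements derivable from $\Gamma\subseteq\mathbb{S}_O$; $\mathrm{Cn}$ is reflexive, monotone and idempotent. $S_O\subseteq\mathbb{S}_O$ is a finite knowledge base, $\hat S_O\subseteq\mathbb{S}_O$ a nonempty finite reconstruction alphabet, and a deductive source is a pair $(S_O,P_O)$ with $P_O$ a probability distribution on $S_O$. Finite-step closure. There is a computable operator $T=T_{\mathsf{PS}}$ on finite subsets of $\mathbb{S}_O$ with: $T(B)\supseteq B$; $B\subseteq B'\Rightarrow T(B)\subseteq T(B')$; with $T^0(B)=B$, $T^{n+1}(B)=T(T^n(B))$ one has $\mathrm{Cn}(B)=\bigcup_{n\ge0}T^n(B)$; and the sequence $T^n(B)$ stabilizes after finitely many iterations. $\delta$-step closure distortion. For an integer $\delta\ge0$, $s\in S_O$, $\hat s\in\hat S_O$: $d_{\mathrm{Cn}}^{\delta}(s,\hat s)=d_{\mathrm{Cn}}^{\delta}(s,\hat s\mid S_O)=0$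 if $S_O\subseteq T^\delta((S_O\setminus\{s\})\cup\{\hat s\})$, and $=1$ otherwise. $\delta$-irredundant core. $A_\delta=\{s\in S_O: s\notin T^\delta(S_O\setminus\{s\})\}$, $P_\delta=P_O(A_\delta)$, and, if $P_\delta>0$, $\pi_\delta(s)=P_O(s)/P_\delta$ for $s\in A_\delta$. For $a\in A_\delta$, $R_\delta(a)=\{\hat s\in\hat S_O: d_{\mathrm{Cn}}^{\delta}(a,\hat s\mid S_O)=0\}$. Rate–depth–distortion function. $R_{\mathrm{sem}}(D,\delta;d_{\mathrm{Cn}}^{\delta},P_O)$ is the minimum of the mutual information $I(\mathsf S_o;\hat{\mathsf S}_o)$ over test channels $P_{\hat S\mid S}$ from $S_O$ to $\hat S_O$ with $\mathbb{E}[d_{\mathrm{Cn}}^{\delta}(\mathsf S_o,\hat{\mathsf S}_o)]\le D$, where $\mathsf S_o\sim P_O$ ($+\infty$ if no such channel exists). $H$ is Shannon entropy. *)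

theory Defs
  imports "HOL-Probability.Probability"
begin

section \<open>Proof system and finite-step closure\<close>

text \<open>
  The finite set of all statements is rendered as a type of class \<^class>\<open>finite\<close>, so that every
  set of statements is finite. Decidability of derivability and computability of the step operator
  hold for all relations and operators on a finite type and need no separate assumption.
\<close>

definition Cn :: "('a set \<Rightarrow> 'a \<Rightarrow> bool) \<Rightarrow> 'a set \<Rightarrow> 'a set" where
  "Cn derives \<Gamma> = {s. derives \<Gamma> s}"

locale finite_step_closure =
  fixes derives :: "'a::finite set \<Rightarrow> 'a \<Rightarrow> bool"
    and T :: "'a set \<Rightarrow> 'a set"
  assumes Cn_reflexive: "\<Gamma> \<subseteq> Cn derives \<Gamma>"
    and Cn_monotone: "\<Gamma> \<subseteq> \<Gamma>' \<Longrightarrow> Cn derives \<Gamma> \<subseteq> Cn derives \<Gamma>'"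
    and Cn_idempotent: "Cn derives (Cn derives \<Gamma>) = Cn derives \<Gamma>"
    and T_extensive: "B \<subseteq> T B"
    and T_monotone: "B \<subseteq> B' \<Longrightarrow> T B \<subseteq> T B'"
    and Cn_eq_Union_T: "Cn derives B = (\<Union>n. (T ^^ n) B)"
    and T_stabilizes: "\<exists>N. \<forall>n\<ge>N. (T ^^ n) B = (T ^^ N) B"

section \<open>Deductive sources, distortion and irredundant core\<close>

definition deductive_source :: "'a set \<Rightarrow> 'a pmf \<Rightarrow> bool" where
  "deductive_source S P \<longleftrightarrow> set_pmf P \<subseteq> S"

definition closure_distortion ::
    "('a set \<Rightarrow> 'a set) \<Rightarrow> 'a set \<Rightarrow> nat \<Rightarrow> 'a \<Rightarrow> 'a \<Rightarrow> real" where
  "closure_distortion T S \<delta> s s' =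
     (if S \<subseteq> (T ^^ \<delta>) ((S - {s}) \<union> {s'}) then 0 else 1)"

definition irredundant_core :: "('a set \<Rightarrow> 'a set) \<Rightarrow> 'a set \<Rightarrow> nat \<Rightarrow> 'a set" where
  "irredundant_core T S \<delta> = {s \<in> S. s \<notin> (T ^^ \<delta>) (S - {s})}"

definition core_prob :: "('a set \<Rightarrow> 'a set) \<Rightarrow> 'a set \<Rightarrow> nat \<Rightarrow> 'a pmf \<Rightarrow> real" where
  "core_prob T S \<delta> P = measure_pmf.prob P (irredundant_core T S \<delta>)"

text \<open>Only meaningful when the core has positive probability; see \<open>pmf_core_pmf\<close>.\<close>

definition core_pmf :: "('a set \<Rightarrow> 'a set) \<Rightarrow> 'a set \<Rightarrow> nat \<Rightarrow> 'a pmf \<Rightarrow> 'a pmf" where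
  "core_pmf T S \<delta> P = cond_pmf P (irredundant_core T S \<delta>)"

lemma pmf_core_pmf:
  assumes "core_prob T S \<delta> P > 0"
  shows "pmf (core_pmf T S \<delta> P) s =
    (if s \<in> irredundant_core T S \<delta> then pmf P s / core_prob T S \<delta> P else 0)"
proof -
  have "set_pmf P \<inter> irredundant_core T S \<delta> \<noteq> {}"
    using assms by (auto simp: core_prob_def measure_pmf_zero_iff[symmetric])
  then show ?thesis
    by (simp add: core_pmf_def core_prob_def pmf_cond)
qed

definition zero_distortion_set ::
    "('a set \<Rightarrow> 'a set) \<Rightarrow> 'a set \<Rightarrow> 'a set \<Rightarrow> nat \<Rightarrow> 'a \<Rightarrow> 'a set" where
  "zero_distortion_set T S Shat \<delta> a = {s' \<in> Shat. closure_distortion T S \<delta> a s' = 0}"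

section \<open>Entropy and rate-depth-distortion function\<close>

definition shannon_entropy :: "real \<Rightarrow> 'a pmf \<Rightarrow> real" where
  "shannon_entropy b p =
     prob_space.entropy (measure_pmf p) b (count_space UNIV) (\<lambda>x. x)"

text \<open>
  A channel is a family of distributions indexed by the source alphabet; its values outside
  that alphabet are irrelevant.
\<close>

definition test_channels :: "'a set \<Rightarrow> 'a set \<Rightarrow> ('a \<Rightarrow> 'a pmf) set" where
  "test_channels S Shat = {W. \<forall>s\<in>S. set_pmf (W s) \<subseteq> Shat}"

definition joint_pmf :: "'a pmf \<Rightarrow> ('a \<Rightarrow> 'a pmf) \<Rightarrow> ('a \<times> 'a) pmf" where
  "joint_pmf P W = bind_pmf P (\<lambda>s. map_pmf (Pair s) (W s))"

definition channel_information :: "real \<Rightarrow> 'a pmf \<Rightarrow> ('a \<Rightarrow> 'a pmf) \<Rightarrow> real" where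
  "channel_information b P W =
     prob_space.mutual_information (measure_pmf (joint_pmf P W)) b
       (count_space UNIV) (count_space UNIV) fst snd"

definition feasible_channels ::
    "('a set \<Rightarrow> 'a set) \<Rightarrow> 'a set \<Rightarrow> 'a set \<Rightarrow> 'a pmf \<Rightarrow> real \<Rightarrow> nat \<Rightarrow> ('a \<Rightarrow> 'a pmf) set" where
  "feasible_channels T S Shat P D \<delta> =
     {W \<in> test_channels S Shat.
        measure_pmf.expectation (joint_pmf P W)
          (\<lambda>(s, s'). closure_distortion T S \<delta> s s') \<le> D}"

text \<open>
  \<^const>\<open>Least\<close> (and not an infimum) because the rate is a minimum. On finite alphabets it is
  attained whenever a feasible channel exists: the feasible set is compact and mutual information
  is continuous in the channel.
\<close>

definition rate_depth_distortion ::
    "real \<Rightarrow> ('a::finite set \<Rightarrow> 'a set) \<Rightarrow> 'a set \<Rightarrow> 'a set \<Rightarrow> 'a pmf \<Rightarrow> real \<Rightarrow> nat \<Rightarrow> ereal" where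
  "rate_depth_distortion b T S Shat P D \<delta> =
     (if feasible_channels T S Shat P D \<delta> = {} then \<infinity>
      else ereal (LEAST r. r \<in> channel_information b P ` feasible_channels T S Shat P D \<delta>))"

end

theory Submission
  imports Defs
begin

text \<open>
  A redundant statement is reconstructed without distortion by every letter, whereas a core statement
  \<open>a\<close> must be sent into \<open>R a\<close>. As these sets are disjoint, the output reveals which core statement was
  sent, so that a Gibbs-type inequality bounds the information below by
  \<open>\<Sum>a\<in>A. P a * log (P(A) / P a) = P(A) * H(\<pi>)\<close>. Equality holds if core statements are
  sent to themselves and redundant ones to a random letter with law \<open>\<pi>\<close>: the output law is then
  \<open>\<pi>\<close> again, and the redundant statements contribute nothing.
\<close>

section \<open>Joint law of source and output, with entropy and information as finite sums\<close>

lemma pmf_joint_pmf: "pmf (joint_pmf P W) (s, t) = pmf P s * pmf (W s) t"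
proof -
  have "pmf (map_pmf (Pair x) (W x)) (s, t) = (if x = s then pmf (W s) t else 0)" for x
  proof (cases "x = s")
    case True
    then show ?thesis
      using pmf_map_inj'[of "Pair s" "W s" t] by (simp add: inj_on_def)
  next
    case False
    then have "Pair x -` {(s, t)} = {}" by auto
    with False show ?thesis by (simp add: pmf_map)
  qed
  then have "pmf (joint_pmf P W) (s, t)
      = measure_pmf.expectation P (\<lambda>x. if x = s then pmf (W s) t else 0)"
    by (simp add: joint_pmf_def pmf_bind)
  also have "\<dots> = pmf P s * pmf (W s) t"
    by (subst integral_measure_pmf_real[of "{s}"]) (auto split: if_splits)
  finally show ?thesis .
qed

lemma map_fst_joint_pmf: "map_pmf fst (joint_pmf P W) = P"
  by (simp add: joint_pmf_def map_bind_pmf pmf.map_comp comp_def bind_return_pmf')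

lemma map_snd_joint_pmf: "map_pmf snd (joint_pmf P W) = bind_pmf P W"
  by (simp add: joint_pmf_def map_bind_pmf pmf.map_comp comp_def)

lemma shannon_entropy_eq_sum:
  fixes p :: "'a::finite pmf"
  assumes "1 < b"
  shows "shannon_entropy b p = - (\<Sum>x\<in>UNIV. pmf p x * log b (pmf p x))"
proof -
  interpret information_space "measure_pmf p" b
    by unfold_locales (use assms in auto)
  have "simple_distributed (measure_pmf p) (\<lambda>x. x) (pmf p)"
    by (rule measure_pmf.simple_distributedI) (auto simp: simple_function_def measure_pmf_single)
  from entropy_simple_distributed[OF this] show ?thesis
    by (simp add: shannon_entropy_def)
qed

lemma channel_information_eq_sum:
  fixes P :: "'a::finite pmf"
  assumes "1 < b"
  shows "channel_information b P W =
    (\<Sum>s\<in>UNIV. \<Sum>t\<in>UNIV. pmf P s * pmf (W s) t * log b (pmf (W s) t / pmf (bind_pmf P W) t))"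
proof -
  let ?J = "joint_pmf P W"
  interpret information_space "measure_pmf ?J" b
    by unfold_locales (use assms in auto)
  have fst: "pmf P x = measure ?J (fst -` {x})" for x
    by (metis map_fst_joint_pmf pmf_map)
  have snd: "pmf (bind_pmf P W) x = measure ?J (snd -` {x})" for x
    by (metis map_snd_joint_pmf pmf_map)
  have X: "simple_distributed (measure_pmf ?J) fst (pmf P)"
    by (rule measure_pmf.simple_distributedI)
      (auto simp: simple_function_def fst)
  have Y: "simple_distributed (measure_pmf ?J) snd (pmf (bind_pmf P W))"
    by (rule measure_pmf.simple_distributedI)
      (auto simp: simple_function_def snd)
  have XY: "simple_distributed (measure_pmf ?J) (\<lambda>x. (fst x, snd x)) (pmf ?J)"
    by (rule measure_pmf.simple_distributedI) (auto simp: simple_function_def measure_pmf_single vimage_def)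
  have "channel_information b P W =
      (\<Sum>(s, t)\<in>UNIV. pmf ?J (s, t) * log b (pmf ?J (s, t) / (pmf P s * pmf (bind_pmf P W) t)))"
    using mutual_information_simple_distributed[OF X Y XY] by (simp add: channel_information_def)
  \<comment> \<open>The factor \<open>pmf P s\<close> cancels inside the logarithm; where it is 0,
    the outer factor makes both terms 0.\<close>
  also have "\<dots> = (\<Sum>(s, t)\<in>UNIV \<times> UNIV.
      pmf P s * pmf (W s) t * log b (pmf (W s) t / pmf (bind_pmf P W) t))"
    by (rule sum.cong) (auto simp: pmf_joint_pmf)
  also have "\<dots> = (\<Sum>s\<in>UNIV. \<Sum>t\<in>UNIV.
      pmf P s * pmf (W s) t * log b (pmf (W s) t / pmf (bind_pmf P W) t))"
    by (rule sum.cartesian_product[symmetric])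
  finally show ?thesis .
qed

section \<open>Lower bound on the information\<close>

lemma sum_pmf_UNIV: "(\<Sum>x\<in>UNIV. pmf p x) = 1" for p :: "'a::finite pmf"
  by (rule sum_pmf_eq_1) auto

text \<open>The joint law is compared with the measure of weight \<open>u s * pmf q t\<close> on the
  pairs with \<open>t\<close> in \<open>B s\<close>, where \<open>q\<close> is the output law. Its
  mass is \<open>p\<close> times the total \<open>q\<close>-mass of the sets \<open>R a\<close>,
  plus \<open>1 - p\<close>; disjointness makes this at most 1, so the divergence of the joint law
  from it is nonnegative. That divergence is the information minus the mean of
  \<open>log b (g s)\<close>, and this mean is the asserted bound.\<close>

lemma channel_information_ge:
  fixes P :: "'a::finite pmf"
  assumes b: "1 < b"
    and disj: "disjoint_family_on R A"
    and supp: "\<And>a. a \<in> A \<Longrightarrow> a \<in> set_pmf P \<Longrightarrow> set_pmf (W a) \<subseteq> R a"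
  shows "(\<Sum>a\<in>A. pmf P a * log b (measure_pmf.prob P A / pmf P a)) \<le> channel_information b P W"
proof -
  define q where "q = bind_pmf P W"
  define p where "p = measure_pmf.prob P A"
  \<comment> \<open>On the support of \<open>P\<close>, \<open>u s = pmf P s * g s\<close>: the
    weight of a core statement is raised to the full probability of \<open>A\<close>, which is
    affordable because its row is cut down to \<open>R s\<close>.\<close>
  define g where "g s = (if s \<in> A then p / pmf P s else 1)" for s
  define u where "u s = (if s \<in> A then p else pmf P s)" for s
  define B where "B s = (if s \<in> A then R s else UNIV)" for s
  have p_nonneg: "0 \<le> p" by (simp add: p_def)
  have u_nonneg: "0 \<le> u s" for s by (simp add: u_def p_nonneg)
  have lnb: "0 < ln b" using b by simp
  \<comment> \<open>\<open>ln z \<ge> 1 - 1/z\<close> at \<open>z = W s t / (q t * g s)\<close>\<close>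
  have le: "(pmf P s * pmf (W s) t - u s * (pmf q t * indicator (B s) t)) / ln b
      \<le> pmf P s * pmf (W s) t * log b (pmf (W s) t / pmf q t)
        - pmf P s * pmf (W s) t * log b (g s)" for s t
  proof (cases "pmf P s = 0 \<or> pmf (W s) t = 0")
    case True
    \<comment> \<open>With a factor 0 the right-hand side is 0 and the left-hand side is not
      positive.\<close>
    have "0 \<le> u s * (pmf q t * indicator (B s) t) / ln b"
      using u_nonneg[of s] lnb by simp
    with True show ?thesis by auto
  next
    case False
    then have Ps: "0 < pmf P s" and Wt: "0 < pmf (W s) t"
      by (simp_all add: pmf_pos)
    have mem: "s \<in> set_pmf P" "t \<in> set_pmf (W s)"
      using False by (simp_all add: set_pmf_iff)
    then have "t \<in> set_pmf q" by (auto simp: q_def)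
    then have qt: "0 < pmf q t" by (rule pmf_positive)
    have "0 < g s"
      using mem measure_pmf_posI[of s P A] Ps by (simp add: g_def p_def)
    \<comment> \<open>The support hypothesis puts \<open>t\<close> where the indicator is 1, so the
      comparison weight is positive.\<close>
    have "t \<in> B s" using supp mem by (auto simp: B_def)
    have ug: "u s = pmf P s * g s" using Ps by (simp add: u_def g_def)
    let ?z = "pmf (W s) t / (pmf q t * g s)"
    have z: "0 < ?z" using Wt qt \<open>0 < g s\<close> by simp
    have "- ln ?z \<le> 1 / ?z - 1"
      using ln_le_minus_one[of "1 / ?z"] z ln_inverse[of ?z]
      by (simp only: inverse_eq_divide zero_less_divide_1_iff)
    then have "(1 - 1 / ?z) / ln b \<le> log b ?z"
      using lnb by (simp add: log_def divide_right_mono)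
    then have "pmf P s * pmf (W s) t * ((1 - 1 / ?z) / ln b) \<le> pmf P s * pmf (W s) t * log b ?z"
      by (intro mult_left_mono) auto
    then have "pmf P s * pmf (W s) t * (1 - 1 / ?z) / ln b \<le> pmf P s * pmf (W s) t * log b ?z"
      by (simp only: times_divide_eq_right)
    moreover have "log b ?z = log b (pmf (W s) t / pmf q t) - log b (g s)"
      using Wt qt \<open>0 < g s\<close> by (simp add: log_def ln_div ln_mult diff_divide_distrib add_divide_distrib)
    moreover have "pmf P s * pmf (W s) t * (1 - 1 / ?z)
        = pmf P s * pmf (W s) t - u s * (pmf q t * indicator (B s) t)"
      using Wt qt \<open>0 < g s\<close> \<open>t \<in> B s\<close> by (simp add: ug field_simps)
    ultimately show ?thesis
      by (simp only: right_diff_distrib)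
  qed
  have PW: "(\<Sum>s\<in>UNIV. \<Sum>t\<in>UNIV. pmf P s * pmf (W s) t) = 1"
    by (simp add: sum_pmf_UNIV flip: sum_distrib_left)
  have qB: "(\<Sum>t\<in>UNIV. pmf q t * indicator X t) = measure_pmf.prob q X" for X
    by (simp add: measure_measure_pmf_finite indicator_def if_distrib sum.If_cases cong: if_cong)
  \<comment> \<open>Disjointness enters here: it keeps the comparison measure at mass at most
    1.\<close>
  have "(\<Sum>a\<in>A. measure_pmf.prob q (R a)) = measure_pmf.prob q (\<Union>a\<in>A. R a)"
    by (rule measure_pmf.finite_measure_finite_Union[symmetric]) (auto simp: disj)
  then have "(\<Sum>a\<in>A. measure_pmf.prob q (R a)) \<le> 1" by simp
  then have "p * (\<Sum>a\<in>A. measure_pmf.prob q (R a)) \<le> p"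
    using p_nonneg by (rule mult_left_le)
  moreover have "(\<Sum>s\<in>-A. pmf P s) = 1 - p"
    using measure_pmf.prob_compl[of A P]
    by (simp add: p_def measure_measure_pmf_finite Compl_eq_Diff_UNIV)
  moreover have "(\<Sum>s\<in>UNIV. \<Sum>t\<in>UNIV. u s * (pmf q t * indicator (B s) t))
      = p * (\<Sum>a\<in>A. measure_pmf.prob q (R a)) + (\<Sum>s\<in>-A. pmf P s)"
  proof -
    have "(\<Sum>s\<in>UNIV. \<Sum>t\<in>UNIV. u s * (pmf q t * indicator (B s) t))
        = (\<Sum>s\<in>UNIV. if s \<in> A then p * measure_pmf.prob q (R s) else pmf P s)"
      by (auto simp: u_def B_def qB simp flip: sum_distrib_left intro!: sum.cong)
    also have "\<dots> = (\<Sum>s\<in>A. p * measure_pmf.prob q (R s)) + (\<Sum>s\<in>-A. pmf P s)"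
      by (simp add: sum.If_cases)
    finally show ?thesis by (simp add: sum_distrib_left)
  qed
  ultimately have "0 \<le> (1 - (\<Sum>s\<in>UNIV. \<Sum>t\<in>UNIV. u s * (pmf q t * indicator (B s) t))) / ln b"
    using lnb by simp
  also have "\<dots> = (\<Sum>s\<in>UNIV. \<Sum>t\<in>UNIV.
      (pmf P s * pmf (W s) t - u s * (pmf q t * indicator (B s) t)) / ln b)"
    by (simp add: sum_subtractf PW flip: sum_divide_distrib)
  also have "\<dots> \<le> (\<Sum>s\<in>UNIV. \<Sum>t\<in>UNIV. pmf P s * pmf (W s) t * log b (pmf (W s) t / pmf q t)
        - pmf P s * pmf (W s) t * log b (g s))"
    by (intro sum_mono le)
  also have "\<dots> = channel_information b P W
      - (\<Sum>s\<in>UNIV. \<Sum>t\<in>UNIV. pmf P s * pmf (W s) t * log b (g s))"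
    by (simp add: channel_information_eq_sum[OF b] q_def sum_subtractf)
  \<comment> \<open>\<open>g\<close> depends on \<open>s\<close> alone and each row of the channel
    sums to 1, so the output drops out.\<close>
  also have "(\<Sum>s\<in>UNIV. \<Sum>t\<in>UNIV. pmf P s * pmf (W s) t * log b (g s))
      = (\<Sum>s\<in>UNIV. pmf P s * log b (g s))"
  proof (rule sum.cong[OF refl])
    fix s
    have "(\<Sum>t\<in>UNIV. pmf P s * pmf (W s) t * log b (g s))
        = pmf P s * log b (g s) * (\<Sum>t\<in>UNIV. pmf (W s) t)"
      by (simp only: sum_distrib_left mult_ac)
    then show "(\<Sum>t\<in>UNIV. pmf P s * pmf (W s) t * log b (g s)) = pmf P s * log b (g s)"
      by (simp add: sum_pmf_UNIV)
  qed
  also have "\<dots> = (\<Sum>s\<in>UNIV. if s \<in> A then pmf P s * log b (p / pmf P s) else 0)"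
    by (rule sum.cong) (simp_all add: g_def)
  also have "\<dots> = (\<Sum>a\<in>A. pmf P a * log b (p / pmf P a))"
    by (simp add: sum.If_cases)
  finally show ?thesis by (simp add: p_def)
qed

section \<open>Output law and information of the optimal channel\<close>

text \<open>The statements in \<open>A\<close> contribute \<open>P(A) * Q\<close> to the output law
  and the others \<open>(1 - P(A)) * Q\<close>. If \<open>P(A) = 0\<close>, the first part is empty
  and \<open>Q\<close> may be any law.\<close>

lemma bind_pmf_identity_on_eq:
  fixes P :: "'a::finite pmf"
  assumes "\<And>s. s \<in> A \<Longrightarrow> pmf P s = measure_pmf.prob P A * pmf Q s"
    and "measure_pmf.prob P A \<noteq> 0 \<Longrightarrow> set_pmf Q \<subseteq> A"
  shows "bind_pmf P (\<lambda>s. if s \<in> A then return_pmf s else Q) = Q"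
proof (rule pmf_eqI)
  fix t
  let ?p = "measure_pmf.prob P A"
  have "pmf (bind_pmf P (\<lambda>s. if s \<in> A then return_pmf s else Q)) t
      = (\<Sum>s\<in>UNIV. if s \<in> A then (if s = t then pmf P t else 0) else pmf Q t * pmf P s)"
    unfolding pmf_bind
    by (subst integral_measure_pmf_real[of UNIV]) (auto intro!: sum.cong simp: indicator_def)
  also have "\<dots> = (if t \<in> A then pmf P t else 0) + pmf Q t * (\<Sum>s\<in>-A. pmf P s)"
    by (simp add: sum.If_cases sum_distrib_left)
  also have "(\<Sum>s\<in>-A. pmf P s) = 1 - ?p"
    using measure_pmf.prob_compl[of A P] by (simp add: measure_measure_pmf_finite Compl_eq_Diff_UNIV)
  \<comment> \<open>For \<open>t\<close> outside \<open>A\<close>, either \<open>?p\<close> is 0 or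
    \<open>Q\<close> vanishes at \<open>t\<close>.\<close>
  also have "(if t \<in> A then pmf P t else 0) = ?p * pmf Q t"
    using assms by (auto simp: pmf_eq_0_set_pmf)
  finally show "pmf (bind_pmf P (\<lambda>s. if s \<in> A then return_pmf s else Q)) t = pmf Q t"
    by (simp add: algebra_simps)
qed

text \<open>The output law is \<open>Q\<close>, so a row outside \<open>A\<close> contributes only
  logarithms of 1. A row inside \<open>A\<close> is a point mass and contributes
  \<open>pmf P s * log b (1 / pmf Q s)\<close>, where proportionality turns
  \<open>1 / pmf Q s\<close> into \<open>P(A) / P s\<close>.\<close>

lemma channel_information_identity_on:
  fixes P :: "'a::finite pmf"
  assumes b: "1 < b"
    and PQ: "\<And>s. s \<in> A \<Longrightarrow> pmf P s = measure_pmf.prob P A * pmf Q s"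
    and supp: "measure_pmf.prob P A \<noteq> 0 \<Longrightarrow> set_pmf Q \<subseteq> A"
  shows "channel_information b P (\<lambda>s. if s \<in> A then return_pmf s else Q)
    = (\<Sum>a\<in>A. pmf P a * log b (measure_pmf.prob P A / pmf P a))"
proof -
  let ?W = "\<lambda>s. if s \<in> A then return_pmf s else Q"
  have bind: "bind_pmf P ?W = Q"
    using PQ supp by (rule bind_pmf_identity_on_eq)
  have "(\<Sum>t\<in>UNIV. pmf P s * pmf (?W s) t * log b (pmf (?W s) t / pmf Q t))
      = (if s \<in> A then pmf P s * log b (measure_pmf.prob P A / pmf P s) else 0)" for s
  proof (cases "s \<in> A")
    case True
    have "(\<Sum>t\<in>UNIV. pmf P s * pmf (?W s) t * log b (pmf (?W s) t / pmf Q t))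
        = (\<Sum>t\<in>UNIV. if t = s then pmf P s * log b (1 / pmf Q s) else 0)"
      using True by (intro sum.cong) (auto simp: indicator_def)
    \<comment> \<open>If \<open>P(A) = 0\<close>, then \<open>pmf P s = 0\<close> and both products
      vanish whatever the logarithms are.\<close>
    also have "\<dots> = pmf P s * log b (measure_pmf.prob P A / pmf P s)"
      using PQ[OF True] by (cases "measure_pmf.prob P A = 0") auto
    finally show ?thesis using True by simp
  next
    case False
    have "pmf Q t * log b (pmf Q t / pmf Q t) = 0" for t
      by (cases "pmf Q t = 0") auto
    with False show ?thesis by (simp only: mult.assoc if_False) simp
  qed
  then have "channel_information b P ?W
      = (\<Sum>s\<in>UNIV. if s \<in> A then pmf P s * log b (measure_pmf.prob P A / pmf P s) else 0)"
    by (simp only: channel_information_eq_sum[OF b] bind)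
  then show ?thesis by (simp add: sum.If_cases)
qed

section \<open>Entropy of the normalised core\<close>

text \<open>Multiplying \<open>- \<pi> * log \<pi>\<close> by \<open>P(A)\<close> cancels the
  normalisation outside the logarithm and leaves \<open>P(A) / P a\<close> inside. On a null core
  every \<open>P a\<close> in the sum is 0, in accordance with the convention.\<close>

lemma core_entropy_eq_sum:
  fixes P :: "'a::finite pmf"
  assumes b: "1 < b"
  shows "(if core_prob T S \<delta> P = 0 then 0
      else core_prob T S \<delta> P * shannon_entropy b (core_pmf T S \<delta> P))
    = (\<Sum>a\<in>irredundant_core T S \<delta>. pmf P a * log b (core_prob T S \<delta> P / pmf P a))"
proof (cases "core_prob T S \<delta> P = 0")
  case True
  then have "pmf P a = 0" if "a \<in> irredundant_core T S \<delta>" for a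
    using that measure_pmf_posI[of a P] by (force simp: core_prob_def set_pmf_iff)
  with True show ?thesis by simp
next
  case False
  let ?A = "irredundant_core T S \<delta>"
  define p where "p = core_prob T S \<delta> P"
  have p: "0 < p" using False by (simp add: p_def core_prob_def zero_less_measure_iff)
  have "p * shannon_entropy b (core_pmf T S \<delta> P)
      = (\<Sum>x\<in>UNIV. if x \<in> ?A then pmf P x * log b (p / pmf P x) else 0)"
    unfolding shannon_entropy_eq_sum[OF b] sum_negf[symmetric] sum_distrib_left
  proof (rule sum.cong[OF refl])
    fix x
    show "p * - (pmf (core_pmf T S \<delta> P) x * log b (pmf (core_pmf T S \<delta> P) x))
        = (if x \<in> ?A then pmf P x * log b (p / pmf P x) else 0)"
      using p pmf_nonneg[of P x]
      by (cases "pmf P x = 0")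
        (auto simp: pmf_core_pmf p_def[symmetric] pmf_pos log_divide field_simps)
  qed
  with False show ?thesis by (simp add: p_def sum.If_cases)
qed

section \<open>Zero distortion and feasibility\<close>

lemma finite_step_closure_subset_funpow:
  assumes "finite_step_closure derives T"
  shows "B \<subseteq> (T ^^ n) B"
proof (induction n)
  case (Suc n)
  then show ?case
    using finite_step_closure.T_extensive[OF assms, of "(T ^^ n) B"] by auto
qed simp

lemma finite_step_closure_funpow_mono:
  assumes "finite_step_closure derives T" and "B \<subseteq> B'"
  shows "(T ^^ n) B \<subseteq> (T ^^ n) B'"
  by (induction n) (auto simp: assms intro: finite_step_closure.T_monotone[OF assms(1), THEN subsetD])

lemma closure_distortion_self:
  assumes "finite_step_closure derives T" and "s \<in> S"
  shows "closure_distortion T S \<delta> s s = 0"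
proof -
  have "S - {s} \<union> {s} = S" using assms(2) by auto
  then show ?thesis
    using finite_step_closure_subset_funpow[OF assms(1)] by (simp add: closure_distortion_def)
qed

text \<open>Extensivity keeps the other statements, redundancy recovers \<open>s\<close> from them,
  and by monotonicity the added letter cannot hurt.\<close>

lemma closure_distortion_redundant:
  assumes "finite_step_closure derives T" and "s \<in> S" "s \<notin> irredundant_core T S \<delta>"
  shows "closure_distortion T S \<delta> s t = 0"
proof -
  have "s \<in> (T ^^ \<delta>) (S - {s})"
    using assms by (simp add: irredundant_core_def)
  then have "S \<subseteq> (T ^^ \<delta>) (S - {s})"
    using finite_step_closure_subset_funpow[OF assms(1), of "S - {s}" \<delta>] by auto
  also have "\<dots> \<subseteq> (T ^^ \<delta>) (S - {s} \<union> {t})"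
    using assms(1) by (rule finite_step_closure_funpow_mono) auto
  finally show ?thesis by (simp add: closure_distortion_def)
qed

lemma set_joint_pmf: "set_pmf (joint_pmf P W) = (SIGMA s:set_pmf P. set_pmf (W s))"
  by (auto simp: joint_pmf_def)

text \<open>Distortion is nonnegative, so an expectation of at most 0 forces it to vanish almost
  surely, that is, on the whole support of the joint law.\<close>

lemma feasible_channels_zero_iff:
  fixes S :: "'a::finite set"
  shows "W \<in> feasible_channels T S Shat P 0 \<delta> \<longleftrightarrow> W \<in> test_channels S Shat \<and>
    (\<forall>s\<in>set_pmf P. \<forall>t\<in>set_pmf (W s). closure_distortion T S \<delta> s t = 0)"
proof -
  let ?J = "measure_pmf (joint_pmf P W)"
  let ?d = "\<lambda>(s, t). closure_distortion T S \<delta> s t"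
  have d: "0 \<le> ?d x" for x by (cases x) (simp add: closure_distortion_def)
  have "0 \<le> (\<integral>x. ?d x \<partial>?J)"
    by (rule Bochner_Integration.integral_nonneg) (rule d)
  then have "(\<integral>x. ?d x \<partial>?J) \<le> 0 \<longleftrightarrow> (\<integral>x. ?d x \<partial>?J) = 0"
    by linarith
  also have "\<dots> \<longleftrightarrow> (AE x in ?J. ?d x = 0)"
    using d by (intro integral_nonneg_eq_0_iff_AE) (auto intro: integrable_measure_pmf_finite)
  finally show ?thesis
    by (auto simp: feasible_channels_def AE_measure_pmf_iff set_joint_pmf)
qed

section \<open>The rate at distortion zero\<close>

theorem mainTheorem5:
  fixes derives :: "'a::finite set \<Rightarrow> 'a \<Rightarrow> bool"
    and T :: "'a set \<Rightarrow> 'a set"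
    and S Shat :: "'a set"
    and P :: "'a pmf"
    and \<delta> :: nat
    and b :: real
  assumes "finite_step_closure derives T"
    and "deductive_source S P"
    and "Shat \<noteq> {}"
    and "1 < b"
    and "irredundant_core T S \<delta> \<subseteq> Shat"
    and "\<And>a\<^sub>1 a\<^sub>2. a\<^sub>1 \<in> irredundant_core T S \<delta> \<Longrightarrow> a\<^sub>2 \<in> irredundant_core T S \<delta> \<Longrightarrow> a\<^sub>1 \<noteq> a\<^sub>2 \<Longrightarrow>
           zero_distortion_set T S Shat \<delta> a\<^sub>1 \<inter> zero_distortion_set T S Shat \<delta> a\<^sub>2 = {}"
  shows "rate_depth_distortion b T S Shat P 0 \<delta> =
    ereal (if core_prob T S \<delta> P = 0 then 0
           else core_prob T S \<delta> P * shannon_entropy b (core_pmf T S \<delta> P))"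
proof -
  let ?A = "irredundant_core T S \<delta>"
  let ?V = "\<Sum>a\<in>?A. pmf P a * log b (measure_pmf.prob P ?A / pmf P a)"
  let ?F = "feasible_channels T S Shat P 0 \<delta>"
  have PS: "set_pmf P \<subseteq> S" using assms(2) by (simp add: deductive_source_def)
  have AS: "?A \<subseteq> S" by (auto simp: irredundant_core_def)
  obtain h where h: "h \<in> Shat" using assms(3) by auto
  \<comment> \<open>\<open>core_pmf\<close> is unspecified on a null core; a point mass at a letter
    of \<open>Shat\<close> then keeps the outputs in the alphabet.\<close>
  define Q where "Q = (if core_prob T S \<delta> P = 0 then return_pmf h else core_pmf T S \<delta> P)"
  define W where "W = (\<lambda>s. if s \<in> ?A then return_pmf s else Q)"
  have pmf_Q: "pmf Q s = (if s \<in> ?A then pmf P s / core_prob T S \<delta> P else 0)"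
    if "core_prob T S \<delta> P \<noteq> 0" for s
    using that pmf_core_pmf[of T S \<delta> P s]
    by (simp add: Q_def core_prob_def zero_less_measure_iff)
  have PQ: "pmf P s = measure_pmf.prob P ?A * pmf Q s" if "s \<in> ?A" for s
  proof (cases "core_prob T S \<delta> P = 0")
    case True
    then show ?thesis
      using that measure_pmf_posI[of s P ?A] by (auto simp: core_prob_def set_pmf_iff)
  next
    case False
    then show ?thesis using that by (simp add: pmf_Q flip: core_prob_def)
  qed
  have QA: "set_pmf Q \<subseteq> ?A" if "measure_pmf.prob P ?A \<noteq> 0"
    using that by (auto simp: set_pmf_iff pmf_Q simp flip: core_prob_def split: if_splits)
  have "set_pmf Q \<subseteq> Shat"
    using QA assms(5) h by (cases "core_prob T S \<delta> P = 0") (auto simp: Q_def core_prob_def)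
  then have feas: "W \<in> ?F"
    using PS AS assms(5) closure_distortion_self[OF assms(1)]
      closure_distortion_redundant[OF assms(1)]
    by (auto simp: feasible_channels_zero_iff test_channels_def W_def)
  have "(LEAST r. r \<in> channel_information b P ` ?F) = ?V"
  proof (rule Least_equality)
    have "channel_information b P W = ?V"
      unfolding W_def by (rule channel_information_identity_on[OF assms(4) PQ QA])
    with feas show "?V \<in> channel_information b P ` ?F" by force
  next
    fix r assume "r \<in> channel_information b P ` ?F"
    then obtain W' where W': "W' \<in> ?F" and r: "r = channel_information b P W'" by auto
    have "disjoint_family_on (zero_distortion_set T S Shat \<delta>) ?A"
      using assms(6) by (auto simp: disjoint_family_on_def)
    \<comment> \<open>Zero expected distortion sends every core statement of positive probability
      into its zero-distortion set, which is the support condition of the lower bound.\<close>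
    then show "?V \<le> r"
      unfolding r using W' PS
      by (intro channel_information_ge[OF assms(4)])
        (fastforce simp: feasible_channels_zero_iff test_channels_def zero_distortion_set_def)+
  qed
  with feas show ?thesis
    unfolding core_entropy_eq_sum[OF assms(4)]
    by (auto simp: rate_depth_distortion_def core_prob_def)
qed

end
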